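(* Let $m\in\mathbb N$ and, for each $j\in[m]$, let $\{\Lambda_{ij}\}_{i\in I}$ (with $\Lambda_{ij}\in L(\mathcal H,\mathcal H_i)$) be a g-frame for $\mathcal H$. Assume that for every collection $\{\tau_j\}_{j\in[m]}$ of pairwise disjoint finite subsets of $I$ and for every $A>0$ there exists a partition $\{\sigma_j\}_{j\in[m]}$ of the set $I\setminus(\tau_1\cup\cdots\cup\tau_m)$ such that the family $\{\Lambda_{ij}\}_{i\in\sigma_j\cup\tau_j,\,j\in[m]}$ has a lower frame bound less than $A$. Then there exists a partition $\{\upsilon_j\}_{j\in[m]}$ of $I$ such that $\{\Lambda_{ij}\}_{i\in\upsilon_j,\,j\in[m]}$ is not a g-frame for $\mathcal H$; that is, these g-frames are not woven.
   Context: $\mathcal H$ and $\mathcal K$ are Hilbert spaces, $I\subset\mathbb N$, $\{\mathcal H_i\}_{i\in I}$ is a sequence of closed subspaces of $\mathcal K$, $L(\mathcal H,\mathcal H_i)$ is the set of bounded linear operators from $\mathcal H$ to $\mathcal H_i$, and $[m]=\{1,\dots,m\}$. A family of operators is a g-frame for $\mathcal H$ with bounds $A,B$ if $A,B>0$ are constants such that, for all $f\in\mathcal H$, the sum of $\|\Lambda f\|^2$ over the members $\Lambda$ of the family lies between $A\|f\|^2$ and $B\|f\|^2$. "Has a lower frame bound less than $A$" means that its optimal lower bound is less than $A$, i.e. there is $f\in\mathcal H$ with $\|f\|=1$ and $\sum_{j\in[m]}\sum_{i\in\sigma_j\cup\tau_j}\|\Lambda_{ij}f\|^2<A$. A partition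 $\{\sigma_j\}_{j\in[m]}$ of a set is a family of pairwise disjoint (possibly empty) subsets whose union is the set. A family of g-frames $\{\Lambda_{ij}\}_{i\in I,j\in[m]}$ (for each $j$, $\{\Lambda_{ij}\}_{i\in I}$ is a g-frame) is woven if there are universal constants $A,B>0$ such that for every partition $\{\sigma_j\}_{j\in[m]}$ of $I$ the family $\{\Lambda_{ij}\}_{i\in\sigma_j,j\in[m]}$ is a g-frame for $\mathcal H$ with lower and upper bounds $A$ and $B$. *)

theory Defs
  imports "HOL-Analysis.Analysis"
begin

text \<open>
  The scalar field is an arbitrary type of class \<open>real_normed_field\<close>. Up to isometric
  isomorphism such a field is either the reals or the complex numbers (a normed division
  algebra with multiplicative norm), so real and complex Hilbert spaces are treated at once.
  Complex conjugation is recovered from \<open>x * conj x = |x|\<^sup>2\<close>.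
\<close>

definition conj_scalar :: "'s::real_normed_field \<Rightarrow> 's"
  where "conj_scalar x = of_real ((norm x)\<^sup>2) / x"

lemma conj_scalar_real: "conj_scalar (x::real) = x"
  by (simp add: conj_scalar_def power2_eq_square)

lemma conj_scalar_complex: "conj_scalar (z::complex) = cnj z"
  by (cases "z = 0") (simp_all add: conj_scalar_def complex_norm_square del: of_real_power)

text \<open>
  Norm, topology and completeness come from the type classes; the last two assumptions tie
  them to the scalar multiplication and to the inner product, which is linear in its first
  argument. Positive definiteness follows from \<open>ip_self\<close>.
\<close>

locale hilbert_space = vector_space scl
  for scl :: "'s::real_normed_field \<Rightarrow> 'h::{real_normed_vector,complete_space} \<Rightarrow> 'h" +
  fixes ip :: "'h \<Rightarrow> 'h \<Rightarrow> 's"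
  assumes ip_add: "ip (x + y) z = ip x z + ip y z"
    and ip_scale: "ip (scl c x) y = c * ip x y"
    and ip_conj: "ip y x = conj_scalar (ip x y)"
    and scale_of_real: "scl (of_real r) x = r *\<^sub>R x"
    and ip_self: "ip x x = of_real ((norm x)\<^sup>2)"

lemma hilbert_space_real:
  "hilbert_space scaleR (inner :: 'a::{real_inner,complete_space} \<Rightarrow> 'a \<Rightarrow> real)"
  by unfold_locales
    (simp_all add: algebra_simps conj_scalar_real inner_commute power2_norm_eq_inner)

lemma hilbert_space_complex:
  "hilbert_space (*) (\<lambda>x y::complex. x * cnj y)"
  by unfold_locales
    (simp_all add: algebra_simps conj_scalar_complex scaleR_conv_of_real complex_norm_square
      del: of_real_power)

definition closed_subspace :: "('s::real_normed_field \<Rightarrow> 'h::{real_normed_vector,complete_space} \<Rightarrow> 'h) \<Rightarrow> 'h set \<Rightarrow> bool"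
  where "closed_subspace scl S \<longleftrightarrow> module.subspace scl S \<and> closed S"

definition bounded_operators ::
  "('s::real_normed_field \<Rightarrow> 'h::{real_normed_vector,complete_space} \<Rightarrow> 'h) \<Rightarrow> ('s \<Rightarrow> 'k::{real_normed_vector,complete_space} \<Rightarrow> 'k) \<Rightarrow> 'k set \<Rightarrow> ('h \<Rightarrow> 'k) set"
  where "bounded_operators scaleH scaleK S =
    {T. Vector_Spaces.linear scaleH scaleK T \<and> (\<exists>C. \<forall>f. norm (T f) \<le> C * norm f) \<and> range T \<subseteq> S}"

text \<open>
  A family of operators is given by an index set \<open>X\<close> and a function \<open>\<Lambda>\<close>. Summability is required
  explicitly because \<open>infsum\<close> is \<open>0\<close> for divergent families.
\<close>

definition g_frame_with_bounds ::
  "'x set \<Rightarrow> ('x \<Rightarrow> 'h::real_normed_vector \<Rightarrow> 'k::real_normed_vector) \<Rightarrow> real \<Rightarrow> real \<Rightarrow> bool"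
  where "g_frame_with_bounds X \<Lambda> A B \<longleftrightarrow> A > 0 \<and> B > 0 \<and>
    (\<forall>f. (\<lambda>x. (norm (\<Lambda> x f))\<^sup>2) summable_on X \<and>
         A * (norm f)\<^sup>2 \<le> (\<Sum>\<^sub>\<infinity>x\<in>X. (norm (\<Lambda> x f))\<^sup>2) \<and>
         (\<Sum>\<^sub>\<infinity>x\<in>X. (norm (\<Lambda> x f))\<^sup>2) \<le> B * (norm f)\<^sup>2)"

definition g_frame ::
  "'x set \<Rightarrow> ('x \<Rightarrow> 'h::real_normed_vector \<Rightarrow> 'k::real_normed_vector) \<Rightarrow> bool"
  where "g_frame X \<Lambda> \<longleftrightarrow> (\<exists>A B. g_frame_with_bounds X \<Lambda> A B)"

definition lower_frame_bound_less ::
  "'x set \<Rightarrow> ('x \<Rightarrow> 'h::real_normed_vector \<Rightarrow> 'k::real_normed_vector) \<Rightarrow> real \<Rightarrow> bool"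
  where "lower_frame_bound_less X \<Lambda> A \<longleftrightarrow>
    (\<exists>f. norm f = 1 \<and> (\<lambda>x. (norm (\<Lambda> x f))\<^sup>2) summable_on X \<and>
         (\<Sum>\<^sub>\<infinity>x\<in>X. (norm (\<Lambda> x f))\<^sup>2) < A)"

definition is_partition :: "nat \<Rightarrow> 'i set \<Rightarrow> (nat \<Rightarrow> 'i set) \<Rightarrow> bool"
  where "is_partition m X \<sigma> \<longleftrightarrow> disjoint_family_on \<sigma> {1..m} \<and> (\<Union>j\<in>{1..m}. \<sigma> j) = X"

text \<open>
  The family \<open>{\<Lambda> i j}\<close> with \<open>j \<in> {1..m}\<close> and \<open>i \<in> \<sigma> j\<close> is indexed by the pairs
  \<open>(j, i) \<in> Sigma {1..m} \<sigma>\<close>.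
\<close>

definition pair_family :: "('i \<Rightarrow> nat \<Rightarrow> 'h \<Rightarrow> 'k) \<Rightarrow> nat \<times> 'i \<Rightarrow> 'h \<Rightarrow> 'k"
  where "pair_family \<Lambda> = (\<lambda>(j, i). \<Lambda> i j)"

definition woven ::
  "nat \<Rightarrow> 'i set \<Rightarrow> ('i \<Rightarrow> nat \<Rightarrow> 'h::real_normed_vector \<Rightarrow> 'k::real_normed_vector) \<Rightarrow> bool"
  where "woven m I \<Lambda> \<longleftrightarrow> (\<exists>A>0. \<exists>B>0. \<forall>\<sigma>. is_partition m I \<sigma> \<longrightarrow>
    g_frame_with_bounds (Sigma {1..m} \<sigma>) (pair_family \<Lambda>) A B)"

end

(*
  Sliding hump: fix finitely many indices in the partition at each stage. Given the indices
  fixed so far, the hypothesis provides a completion and a unit vector f on which the completed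
  family is small; only finitely many operators, from all the m frames together, contribute
  significantly to f, so fixing the completion on these indices makes the family small on f
  for every later completion. The limit partition then violates every lower frame bound.
*)

theory Submission
  imports Defs
begin

lemma summable_on_finite_tail_less:
  fixes g :: "'a \<Rightarrow> real"
  assumes "g summable_on X" "\<epsilon> > 0"
  obtains F where "finite F" "F \<subseteq> X" "infsum g (X - F) < \<epsilon>"
proof -
  \<comment> \<open>The approximation is only non-strict, so half of \<epsilon> is spent on it to
    leave a strict bound on the tail.\<close>
  obtain F where F: "finite F" "F \<subseteq> X" "dist (sum g F) (infsum g X) \<le> \<epsilon>/2"
    using infsum_finite_approximation[OF assms(1), of "\<epsilon>/2"] assms(2) by auto
  have "infsum g (X - F) = infsum g X - infsum g F"
    using F assms(1) by (intro infsum_Diff) auto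
  moreover have "infsum g X - sum g F \<le> \<epsilon>/2"
    using F(3) unfolding dist_real_def by linarith
  ultimately have "infsum g (X - F) < \<epsilon>"
    using F(1) assms(2) by simp
  with F that show thesis by blast
qed

lemma summable_on_finite_Sigma:
  fixes g :: "'a \<times> 'b \<Rightarrow> real"
  assumes "finite J" "\<And>j. j \<in> J \<Longrightarrow> (\<lambda>i. g (j, i)) summable_on X"
  shows "g summable_on (J \<times> X)"
  using assms
proof (induction rule: finite_induct)
  case (insert j J)
  have "g summable_on Pair j ` X"
    using insert.prems[of j] by (subst summable_on_reindex) (auto simp: inj_on_def o_def)
  moreover have "g summable_on J \<times> X"
    using insert by auto
  moreover have "insert j J \<times> X = Pair j ` X \<union> J \<times> X" by auto
  ultimately show ?case by (metis summable_on_union)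
qed simp

definition partial_partition :: "nat \<Rightarrow> 'i set \<Rightarrow> (nat \<Rightarrow> 'i set) \<Rightarrow> bool"
  where "partial_partition m X \<tau> \<longleftrightarrow> disjoint_family_on \<tau> {1..m} \<and>
    (\<forall>j\<in>{1..m}. finite (\<tau> j) \<and> \<tau> j \<subseteq> X)"

text \<open>One stage of the construction. Any partition extending \<tau>' uses pairs of two sorts:
  those in the completed family, of total weight below \<epsilon> on \<open>f\<close>, and those in
  a tail of the whole product, again below \<epsilon>; hence the bound 2\<epsilon>. The set
  \<open>E\<close> is a free parameter by which the caller forces prescribed indices to be assigned,
  so that nothing is left over in the limit.\<close>

lemma partial_partition_extend:
  fixes \<Lambda> :: "'i \<Rightarrow> nat \<Rightarrow> 'h::real_normed_vector \<Rightarrow> 'k::real_normed_vector"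
  assumes summ: "\<And>f. (\<lambda>x. (norm (pair_family \<Lambda> x f))\<^sup>2) summable_on ({1..m} \<times> X)"
    and \<tau>: "partial_partition m X \<tau>"
    and \<sigma>: "is_partition m (X - (\<Union>j\<in>{1..m}. \<tau> j)) \<sigma>"
    and low: "lower_frame_bound_less (Sigma {1..m} (\<lambda>j. \<sigma> j \<union> \<tau> j)) (pair_family \<Lambda>) \<epsilon>"
    and "\<epsilon> > 0" and "finite E"
  obtains \<tau>' f where "partial_partition m X \<tau>'" "\<forall>j\<in>{1..m}. \<tau> j \<subseteq> \<tau>' j"
    "X \<inter> E \<subseteq> (\<Union>j\<in>{1..m}. \<tau>' j)" "norm f = 1"
    "\<And>\<upsilon>. is_partition m X \<upsilon> \<Longrightarrow> \<forall>j\<in>{1..m}. \<tau>' j \<subseteq> \<upsilon> j \<Longrightarrow>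
       (\<Sum>\<^sub>\<infinity>x\<in>Sigma {1..m} \<upsilon>. (norm (pair_family \<Lambda> x f))\<^sup>2) < 2 * \<epsilon>"
proof -
  obtain f where f: "norm f = 1"
    and fless: "(\<Sum>\<^sub>\<infinity>x\<in>Sigma {1..m} (\<lambda>j. \<sigma> j \<union> \<tau> j). (norm (pair_family \<Lambda> x f))\<^sup>2) < \<epsilon>"
    using low unfolding lower_frame_bound_less_def by auto
  define g where "g = (\<lambda>x. (norm (pair_family \<Lambda> x f))\<^sup>2)"
  have g: "g summable_on ({1..m} \<times> X)" and g0: "\<And>x. g x \<ge> 0"
    using summ by (auto simp: g_def)
  \<comment> \<open>The tail is cut from all pairs, not just from the completed family, since a
    later partition may assign an index outside \<open>F\<close> to any of the \<open>m\<close>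
    frames.\<close>
  obtain F where F: "finite F" "F \<subseteq> {1..m} \<times> X" "infsum g ({1..m} \<times> X - F) < \<epsilon>"
    using summable_on_finite_tail_less[OF g \<open>\<epsilon> > 0\<close>] .
  define E' where "E' = E \<union> snd ` F"
  \<comment> \<open>The new indices are placed exactly where the completion \<sigma> puts them;
    intersecting with the finite \<open>E'\<close> keeps the classes finite.\<close>
  define \<tau>' where "\<tau>' j = \<tau> j \<union> (\<sigma> j \<inter> E')" for j
  have E': "finite E'" using F \<open>finite E\<close> by (simp add: E'_def)
  have \<sigma>d: "disjoint_family_on \<sigma> {1..m}"
    and \<sigma>U: "(\<Union>j\<in>{1..m}. \<sigma> j) = X - (\<Union>j\<in>{1..m}. \<tau> j)"
    using \<sigma> by (auto simp: is_partition_def)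
  have \<tau>d: "disjoint_family_on \<tau> {1..m}" and \<tau>X: "\<And>j. j \<in> {1..m} \<Longrightarrow> finite (\<tau> j) \<and> \<tau> j \<subseteq> X"
    using \<tau> by (auto simp: partial_partition_def)
  have \<sigma>\<tau>: "\<sigma> j \<inter> \<tau> k = {}" "\<sigma> j \<subseteq> X" if "j \<in> {1..m}" "k \<in> {1..m}" for j k
    using \<sigma>U that by blast+
  have disj: "disjoint_family_on \<tau>' {1..m}"
    unfolding disjoint_family_on_def
  proof (intro ballI impI)
    fix j k assume jk: "j \<in> {1..m}" "k \<in> {1..m}" "j \<noteq> k"
    then have "\<tau> j \<inter> \<tau> k = {}" "\<sigma> j \<inter> \<sigma> k = {}"
      using \<tau>d \<sigma>d by (auto simp: disjoint_family_on_def)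
    then show "\<tau>' j \<inter> \<tau>' k = {}"
      using \<sigma>\<tau>(1)[OF jk(1,2)] \<sigma>\<tau>(1)[OF jk(2,1)] by (auto simp: \<tau>'_def)
  qed
  have cover: "X \<inter> E' \<subseteq> (\<Union>j\<in>{1..m}. \<tau>' j)"
  proof
    fix i assume i: "i \<in> X \<inter> E'"
    then have "i \<in> (\<Union>j\<in>{1..m}. \<sigma> j) \<or> i \<in> (\<Union>j\<in>{1..m}. \<tau> j)" using \<sigma>U by blast
    then show "i \<in> (\<Union>j\<in>{1..m}. \<tau>' j)" using i unfolding \<tau>'_def by blast
  qed
  show thesis
  proof (rule that[of \<tau>' f])
    show "partial_partition m X \<tau>'"
      using disj E' \<tau>X \<sigma>\<tau>(2) by (fastforce simp: partial_partition_def \<tau>'_def)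
    show "\<forall>j\<in>{1..m}. \<tau> j \<subseteq> \<tau>' j" by (simp add: \<tau>'_def)
    show "X \<inter> E \<subseteq> (\<Union>j\<in>{1..m}. \<tau>' j)" using cover by (auto simp: E'_def)
    show "norm f = 1" by fact
    fix \<upsilon> assume \<upsilon>: "is_partition m X \<upsilon>" and sub: "\<forall>j\<in>{1..m}. \<tau>' j \<subseteq> \<upsilon> j"
    let ?S = "Sigma {1..m} (\<lambda>j. \<sigma> j \<union> \<tau> j)"
    let ?R = "{1..m} \<times> X - F"
    have \<upsilon>d: "disjoint_family_on \<upsilon> {1..m}" and \<upsilon>X: "\<And>j. j \<in> {1..m} \<Longrightarrow> \<upsilon> j \<subseteq> X"
      using \<upsilon> by (auto simp: is_partition_def)
    \<comment> \<open>If a pair (j, i) of \<upsilon> lies in \<open>F\<close>, then i is already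
      assigned to some class k of \<tau>'. Since \<upsilon> extends \<tau>' and is disjoint, k = j,
      so the pair belongs to the completed family.\<close>
    have "Sigma {1..m} \<upsilon> \<subseteq> ?S \<union> ?R"
    proof (rule subsetI, rule UnCI)
      fix x assume x: "x \<in> Sigma {1..m} \<upsilon>" "x \<notin> ?R"
      obtain j i where xji: "x = (j, i)" by fastforce
      with x have ji: "j \<in> {1..m}" "i \<in> \<upsilon> j" "(j, i) \<notin> ?R" by auto
      then have "(j, i) \<in> F" and "i \<in> X" using \<upsilon>X by auto
      then have "i \<in> X \<inter> E'" by (force simp: E'_def)
      then obtain k where k: "k \<in> {1..m}" "i \<in> \<tau>' k" using cover by blast
      then have "i \<in> \<upsilon> k" using sub by blast
      then have "k = j" using \<upsilon>d ji(1,2) k(1) unfolding disjoint_family_on_def by blast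
      then show "x \<in> ?S"
        using k xji by (auto simp: \<tau>'_def)
    qed
    \<comment> \<open>The tail may overlap the completed family; removing the overlap makes the sum
      additive over the union.\<close>
    then have subset: "Sigma {1..m} \<upsilon> \<subseteq> ?S \<union> (?R - ?S)" by blast
    have S: "g summable_on ?S" and R: "g summable_on ?R" and V: "g summable_on Sigma {1..m} \<upsilon>"
      and RS: "g summable_on (?R - ?S)"
      by (rule summable_on_subset_banach[OF g]; use \<upsilon>X \<tau>X \<sigma>\<tau>(2) in blast)+
    have "infsum g (Sigma {1..m} \<upsilon>) \<le> infsum g (?S \<union> (?R - ?S))"
      using V S RS subset g0 by (intro infsum_mono_neutral summable_on_union) auto
    also have "\<dots> = infsum g ?S + infsum g (?R - ?S)"
      using S RS by (intro infsum_Un_disjoint) auto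
    also have "infsum g (?R - ?S) \<le> infsum g ?R"
      using R RS g0 by (intro infsum_mono_neutral) auto
    finally show "(\<Sum>\<^sub>\<infinity>x\<in>Sigma {1..m} \<upsilon>. (norm (pair_family \<Lambda> x f))\<^sup>2) < 2 * \<epsilon>"
      using fless F(3) by (simp add: g_def)
  qed
qed

text \<open>Disjointness survives the limit because two memberships at stages a and b both hold at
  stage \<open>max a b\<close>.\<close>

lemma is_partition_Union_chain:
  fixes T :: "nat \<Rightarrow> nat \<Rightarrow> 'i set"
  assumes part: "\<And>n. partial_partition m X (T n)"
    and mono: "\<And>n j. j \<in> {1..m} \<Longrightarrow> T n j \<subseteq> T (Suc n) j"
    and cover: "\<And>i. i \<in> X \<Longrightarrow> \<exists>n. i \<in> (\<Union>j\<in>{1..m}. T n j)"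
  shows "is_partition m X (\<lambda>j. \<Union>n. T n j)"
proof -
  have le: "T n j \<subseteq> T n' j" if "n \<le> n'" "j \<in> {1..m}" for n n' j
    by (rule lift_Suc_mono_le[of "\<lambda>n. T n j"]) (use mono that in auto)
  have "disjoint_family_on (\<lambda>j. \<Union>n. T n j) {1..m}"
    unfolding disjoint_family_on_def
  proof (intro ballI impI equals0I)
    fix j k i assume jk: "j \<in> {1..m}" "k \<in> {1..m}" "j \<noteq> k"
      and "i \<in> (\<Union>n. T n j) \<inter> (\<Union>n. T n k)"
    then obtain a b where "i \<in> T a j" "i \<in> T b k" by blast
    then have "i \<in> T (max a b) j" "i \<in> T (max a b) k"
      using le[of a "max a b" j] le[of b "max a b" k] jk by auto
    then show False
      using part[of "max a b"] jk unfolding partial_partition_def disjoint_family_on_def by blast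
  qed
  moreover have "(\<Union>j\<in>{1..m}. \<Union>n. T n j) = X"
  proof
    show "(\<Union>j\<in>{1..m}. \<Union>n. T n j) \<subseteq> X"
      using part by (auto simp: partial_partition_def)
    show "X \<subseteq> (\<Union>j\<in>{1..m}. \<Union>n. T n j)"
      using cover by blast
  qed
  ultimately show ?thesis by (simp add: is_partition_def)
qed

lemma exists_partition_not_g_frame:
  fixes \<Lambda> :: "nat \<Rightarrow> nat \<Rightarrow> 'h::real_normed_vector \<Rightarrow> 'k::real_normed_vector"
  assumes summ: "\<And>f. (\<lambda>x. (norm (pair_family \<Lambda> x f))\<^sup>2) summable_on ({1..m} \<times> X)"
    and low: "\<And>\<tau> A. partial_partition m X \<tau> \<Longrightarrow> A > 0 \<Longrightarrow>
      \<exists>\<sigma>. is_partition m (X - (\<Union>j\<in>{1..m}. \<tau> j)) \<sigma> \<and>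
          lower_frame_bound_less (Sigma {1..m} (\<lambda>j. \<sigma> j \<union> \<tau> j)) (pair_family \<Lambda>) A"
  shows "\<exists>\<upsilon>. is_partition m X \<upsilon> \<and> \<not> g_frame (Sigma {1..m} \<upsilon>) (pair_family \<Lambda>)"
proof -
  \<comment> \<open>The smallness clause speaks of every partition extending \<tau>', so it can be
    applied to the limit partition, which is not yet known. The sets {..n} exhaust the natural
    numbers, and 1/(n+1) serves as the \<epsilon> of stage n.\<close>
  define Q where "Q n \<tau> \<tau>' \<longleftrightarrow> (\<forall>j\<in>{1..m}. \<tau> j \<subseteq> \<tau>' j) \<and> X \<inter> {..n} \<subseteq> (\<Union>j\<in>{1..m}. \<tau>' j) \<and>
      (\<exists>f. norm f = 1 \<and> (\<forall>\<upsilon>. is_partition m X \<upsilon> \<longrightarrow> (\<forall>j\<in>{1..m}. \<tau>' j \<subseteq> \<upsilon> j) \<longrightarrow>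
        (\<Sum>\<^sub>\<infinity>x\<in>Sigma {1..m} \<upsilon>. (norm (pair_family \<Lambda> x f))\<^sup>2) < 2 * inverse (real (Suc n))))"
    for n \<tau> \<tau>'
  \<comment> \<open>Dependent choice is called for, as the completion and the vector at stage n
    depend on the indices fixed before. All classes start empty.\<close>
  have "\<exists>T. \<forall>n. partial_partition m X (T n) \<and> Q n (T n) (T (Suc n))"
  proof (rule dependent_nat_choice)
    show "\<exists>\<tau>. partial_partition m X \<tau>"
      by (rule exI[of _ "\<lambda>_. {}"]) (simp add: partial_partition_def disjoint_family_on_def)
    fix \<tau> n assume \<tau>: "partial_partition m X \<tau>"
    have pos: "inverse (real (Suc n)) > 0" by simp
    obtain \<sigma> where "is_partition m (X - (\<Union>j\<in>{1..m}. \<tau> j)) \<sigma>"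
      "lower_frame_bound_less (Sigma {1..m} (\<lambda>j. \<sigma> j \<union> \<tau> j)) (pair_family \<Lambda>)
         (inverse (real (Suc n)))"
      using low[OF \<tau> pos] by blast
    from partial_partition_extend[OF summ \<tau> this pos finite_atMost[of n]]
    obtain \<tau>' f where "partial_partition m X \<tau>'" "\<forall>j\<in>{1..m}. \<tau> j \<subseteq> \<tau>' j"
      "X \<inter> {..n} \<subseteq> (\<Union>j\<in>{1..m}. \<tau>' j)" "norm f = 1"
      "\<And>\<upsilon>. is_partition m X \<upsilon> \<Longrightarrow> \<forall>j\<in>{1..m}. \<tau>' j \<subseteq> \<upsilon> j \<Longrightarrow>
       (\<Sum>\<^sub>\<infinity>x\<in>Sigma {1..m} \<upsilon>. (norm (pair_family \<Lambda> x f))\<^sup>2) < 2 * inverse (real (Suc n))"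
      by blast
    then show "\<exists>\<tau>'. partial_partition m X \<tau>' \<and> Q n \<tau> \<tau>'"
      unfolding Q_def by blast
  qed
  then obtain T where T: "\<And>n. partial_partition m X (T n)" and Q: "\<And>n. Q n (T n) (T (Suc n))"
    by blast
  define \<upsilon> where "\<upsilon> = (\<lambda>j. \<Union>n. T n j)"
  have \<upsilon>: "is_partition m X \<upsilon>"
    unfolding \<upsilon>_def
  proof (rule is_partition_Union_chain[OF T])
    show "T n j \<subseteq> T (Suc n) j" if "j \<in> {1..m}" for n j
      using Q[of n] that unfolding Q_def by blast
    show "\<exists>n. i \<in> (\<Union>j\<in>{1..m}. T n j)" if "i \<in> X" for i
    proof -
      \<comment> \<open>The step out of stage i assigns index i, so it appears at stage
        \<open>Suc i\<close> at the latest.\<close>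
      have "X \<inter> {..i} \<subseteq> (\<Union>j\<in>{1..m}. T (Suc i) j)"
        using Q[of i] unfolding Q_def by blast
      then show ?thesis using that by blast
    qed
  qed
  have "\<not> g_frame_with_bounds (Sigma {1..m} \<upsilon>) (pair_family \<Lambda>) A B" for A B
  proof
    assume fr: "g_frame_with_bounds (Sigma {1..m} \<upsilon>) (pair_family \<Lambda>) A B"
    \<comment> \<open>Halving absorbs the factor 2 in \<open>Q\<close>: the sum at the unit vector
      of stage n falls below 2/(n+1) < A, against the lower bound.\<close>
    then have "A / 2 > 0" by (simp add: g_frame_with_bounds_def)
    then obtain n where n: "inverse (real (Suc n)) < A / 2"
      using reals_Archimedean by blast
    have "\<forall>j\<in>{1..m}. T (Suc n) j \<subseteq> \<upsilon> j" by (auto simp: \<upsilon>_def)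
    with Q[of n] \<upsilon> obtain f where "norm f = 1"
      "(\<Sum>\<^sub>\<infinity>x\<in>Sigma {1..m} \<upsilon>. (norm (pair_family \<Lambda> x f))\<^sup>2) < 2 * inverse (real (Suc n))"
      unfolding Q_def by blast
    moreover have "A * (norm f)\<^sup>2 \<le> (\<Sum>\<^sub>\<infinity>x\<in>Sigma {1..m} \<upsilon>. (norm (pair_family \<Lambda> x f))\<^sup>2)"
      using fr by (simp add: g_frame_with_bounds_def)
    ultimately show False using n by simp
  qed
  with \<upsilon> show ?thesis by (auto simp: g_frame_def)
qed

theorem theorem3p3:
  fixes scaleH :: "'s::real_normed_field \<Rightarrow> 'h::{real_normed_vector,complete_space} \<Rightarrow> 'h"
    and scaleK :: "'s \<Rightarrow> 'k::{real_normed_vector,complete_space} \<Rightarrow> 'k"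
    and ipH :: "'h \<Rightarrow> 'h \<Rightarrow> 's"
    and ipK :: "'k \<Rightarrow> 'k \<Rightarrow> 's"
    and I :: "nat set"
    and Hs :: "nat \<Rightarrow> 'k set"
    and m :: nat
    and \<Lambda> :: "nat \<Rightarrow> nat \<Rightarrow> 'h \<Rightarrow> 'k"
  assumes "hilbert_space scaleH ipH"
    and "hilbert_space scaleK ipK"
    and "\<And>i. i \<in> I \<Longrightarrow> closed_subspace scaleK (Hs i)"
    and "\<And>i j. i \<in> I \<Longrightarrow> j \<in> {1..m} \<Longrightarrow> \<Lambda> i j \<in> bounded_operators scaleH scaleK (Hs i)"
    and "\<And>j. j \<in> {1..m} \<Longrightarrow> g_frame I (\<lambda>i. \<Lambda> i j)"
    and "\<And>\<tau> A. disjoint_family_on \<tau> {1..m} \<Longrightarrow>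
           (\<And>j. j \<in> {1..m} \<Longrightarrow> finite (\<tau> j) \<and> \<tau> j \<subseteq> I) \<Longrightarrow> A > 0 \<Longrightarrow>
           \<exists>\<sigma>. is_partition m (I - (\<Union>j\<in>{1..m}. \<tau> j)) \<sigma> \<and>
               lower_frame_bound_less (Sigma {1..m} (\<lambda>j. \<sigma> j \<union> \<tau> j)) (pair_family \<Lambda>) A"
  shows "(\<exists>\<upsilon>. is_partition m I \<upsilon> \<and> \<not> g_frame (Sigma {1..m} \<upsilon>) (pair_family \<Lambda>))
         \<and> \<not> woven m I \<Lambda>"
proof -
  \<comment> \<open>The product is a finite union of copies of \<open>I\<close>, one for each frame,
    and each frame is summable at \<open>f\<close>.\<close>
  have "(\<lambda>x. (norm (pair_family \<Lambda> x f))\<^sup>2) summable_on ({1..m} \<times> I)" for f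
    using assms(5)
    by (intro summable_on_finite_Sigma)
      (auto simp: pair_family_def g_frame_def g_frame_with_bounds_def)
  then have *: "\<exists>\<upsilon>. is_partition m I \<upsilon> \<and> \<not> g_frame (Sigma {1..m} \<upsilon>) (pair_family \<Lambda>)"
    by (rule exists_partition_not_g_frame) (rule assms(6); simp add: partial_partition_def)
  then show ?thesis
    unfolding woven_def g_frame_def by blast
qed

end
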